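(* Let $\tau=\frac{1+\sqrt5}{2}$ and let $\epsilon\in\mathbb{R}$ be such that $A=\tau-\frac{\epsilon}{\tau}>0$ and $B=1+\epsilon>0$. Let $\kappa=A/B$, and let $x_m=\left\|\frac{m}{\tau}\right\|A+\left(m-\left\|\frac{m}{\tau}\right\|\right)B$, $m\in\mathbb{Z}$, be the modified Fibonacci chain. Then the diffraction pattern of $(x_m)$ is commensurate (i.e. the intensities of the peaks form a periodic pattern) if and only if $\kappa$ is rational. Moreover, if $\kappa=p/q$ with $p,q$ positive integers, then the diffraction pattern is periodic with period $\frac{2\pi p}{A}$.
   Context: $\|x\|$ denotes the nearest integer to the real number $x$, with half-integers rounded up: if $m\in\mathbb{Z}$ and $m\le x<m+1$, then $\|x\|=m$ for $x\in[m,m+\frac12)$ and $\|x\|=m+1$ for $x\in[m+\frac12,m+1)$. The structure factor at $k\in\mathbb{R}$ is $F(k)=\lim_{N\to\infty}\frac1N\sum_{m=1}^N e^{ikx_m}$ and the normalized intensity is $I(k)=|F(k)|^2$. Put $a=\frac{\tau+2}{\tau+1}$, $k_0=\frac{2\pi}{a}$, $q_0=\frac{2\pi}{\tau a}$. The set of peak positions is the additive group $S=\{n_1k_0+n_2q_0: n_1,n_2\in\mathbb{Z}\}\subset\mathbb{R}$, which does not depend on $\epsilon$. The diffraction pattern is periodic with period $P$, where $P\in\mathbb{R}\setminus\{0\}$, if $S+P=S$ and $I(K+P)=I(K)$ for all $K\in S$; it is called commensurate if it is periodic with some period $P\neq0$. *)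

theory Defs
  imports Complex_Main
begin

definition golden :: real where
  "golden = (1 + sqrt 5) / 2"

text \<open>The library function \<^const>\<open>round\<close> is \<open>round x = \<lfloor>x + 1/2\<rfloor>\<close>: the nearest integer,
  with half-integers rounded up.\<close>

definition fibonacci_chain :: "real \<Rightarrow> real \<Rightarrow> int \<Rightarrow> real" where
  "fibonacci_chain A B m =
     of_int (round (of_int m / golden)) * A + of_int (m - round (of_int m / golden)) * B"

text \<open>\<^const>\<open>lim\<close> is unspecified for a divergent sequence; for the chains considered here the
  limit exists for every peak position \<open>k\<close>, by equidistribution of \<open>m / golden\<close> modulo 1.\<close>

definition structure_factor :: "(int \<Rightarrow> real) \<Rightarrow> real \<Rightarrow> complex" where
  "structure_factor x k =
     lim (\<lambda>N::nat. (1 / of_nat N) * (\<Sum>m=1..N. exp (\<i> * complex_of_real (k * x (int m)))))"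

definition intensity :: "(int \<Rightarrow> real) \<Rightarrow> real \<Rightarrow> real" where
  "intensity x k = (cmod (structure_factor x k))\<^sup>2"

definition mean_spacing :: real where
  "mean_spacing = (golden + 2) / (golden + 1)"

definition k\<^sub>0 :: real where
  "k\<^sub>0 = 2 * pi / mean_spacing"

definition q\<^sub>0 :: real where
  "q\<^sub>0 = 2 * pi / (golden * mean_spacing)"

definition peak_positions :: "real set" where
  "peak_positions = {of_int n\<^sub>1 * k\<^sub>0 + of_int n\<^sub>2 * q\<^sub>0 | n\<^sub>1 n\<^sub>2 :: int. True}"

definition diffraction_periodic :: "(int \<Rightarrow> real) \<Rightarrow> real \<Rightarrow> bool" where
  "diffraction_periodic x P \<longleftrightarrow>
     P \<noteq> 0 \<and> (\<lambda>K. K + P) ` peak_positions = peak_positions \<and>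
     (\<forall>K\<in>peak_positions. intensity x (K + P) = intensity x K)"

definition commensurate :: "(int \<Rightarrow> real) \<Rightarrow> bool" where
  "commensurate x \<longleftrightarrow> (\<exists>P. diffraction_periodic x P)"

end

theory Submission
  imports Defs "HOL-Analysis.Kronecker_Approximation_Theorem" "HOL-Computational_Algebra.Polynomial"
begin

text \<open>Writing \<open>u\<^sub>m\<close> for the fractional part of \<open>m / \<tau> + 1/2\<close>, the chain is
  \<open>x\<^sub>m = a m - (A - B) (u\<^sub>m - 1/2)\<close>, and \<open>u\<^sub>m\<close> is equidistributed.  Hence the structure factor at
  \<open>n\<^sub>1 k\<^sub>0 + n\<^sub>2 q\<^sub>0\<close> is \<open>sin y / y\<close> with \<open>y = \<pi> ((n\<^sub>1 + n\<^sub>2) B - n\<^sub>1 A) / a\<close>.  As \<open>y\<close> is additive in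
  \<open>(n\<^sub>1, n\<^sub>2)\<close>, each nonzero peak position with \<open>y = 0\<close> is a period; conversely a period has the
  intensity 1 of the origin, which forces \<open>y = 0\<close> and so \<open>A / B = (n\<^sub>1 + n\<^sub>2) / n\<^sub>1\<close>.\<close>

section \<open>Irrationality of the golden ratio\<close>

text \<open>As a root of the monic integer polynomial x^2 - x - 1, a rational golden ratio would be
  an integer, but it lies strictly between 1 and 2.\<close>

lemma golden_irrational: "golden \<notin> \<rat>"
proof
  assume "golden \<in> \<rat>"
  moreover have "algebraic_int golden"
  proof (rule algebraic_int.intros[of "[:-1, -1, 1:]"])
    show "poly [:-1, -1, 1:] golden = 0"
      by (simp add: golden_def field_simps)
  qed (auto simp: coeff_pCons split: nat.splits)
  ultimately have "golden \<in> \<int>"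
    by (rule rational_algebraic_int_is_int[rotated])
  then obtain n :: int where n: "golden = of_int n"
    by (auto elim: Ints_cases)
  have "2 < sqrt 5" "sqrt 5 < 3"
    by (auto intro: real_less_rsqrt real_less_lsqrt)
  then have "1 < golden" "golden < 2"
    by (auto simp: golden_def)
  then have "1 < n" "n < 2"
    unfolding n by simp_all
  then show False
    by linarith
qed

section \<open>Equidistribution of irrational rotations\<close>

text \<open>With \<open>\<alpha>\<close> within \<open>1 / n\<^sup>2\<close> of \<open>h / n\<close>, the \<open>m\<close>-th point lies, modulo 1, within \<open>2 / n\<close> of the
  grid point whose index is the residue of \<open>\<lfloor>n \<theta>\<rfloor> + m h\<close>, and these residues run through all
  classes.  Only the two extreme residues can be separated from their point by the jump at 0.\<close>

lemma rotation_block_sum: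
  fixes E :: "real \<Rightarrow> 'a::real_normed_vector" and n :: nat and h :: int
  assumes n: "n > 0" and cop: "coprime h (int n)"
    and appr: "\<bar>\<alpha> - of_int h / of_nat n\<bar> < 1 / (of_nat n)\<^sup>2"
    and lip: "\<And>x y. x \<in> {0..1} \<Longrightarrow> y \<in> {0..1} \<Longrightarrow> norm (E x - E y) \<le> C * \<bar>x - y\<bar>"
  shows "norm ((\<Sum>m=1..n. E (frac (\<theta> + of_nat m * \<alpha>))) - (\<Sum>l<n. E (of_nat l / of_nat n))) \<le> 4 * C"
proof -
  define k where "k = \<lfloor>of_nat n * \<theta>\<rfloor>"
  define s where "s = frac (of_nat n * \<theta>)"
  define l where "l m = nat ((k + int m * h) mod int n)" for m
  \<comment> \<open>Error charged to the grid point \<open>j / n\<close>: a displacement of at most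
    \<open>2 / n\<close> costs \<open>2 * C / n\<close>; at the two end residues, where the point
    may wrap around, the trivial displacement 1 costs \<open>C\<close>. The total is at most
    \<open>2 * C + 2 * C\<close>.\<close>
  define bd where "bd j = 2 * C / of_nat n + (if j \<in> {0, n - 1} then C else 0)" for j :: nat
  have C: "C \<ge> 0"
    using order_trans[OF norm_ge_zero lip[of 0 1]] by simp
  have l_int: "int (l m) = (k + int m * h) mod int n" for m
    using n by (simp add: l_def)
  have bij: "bij_betw l {1..n} {..<n}"
  proof -
    have "inj_on l {1..n}"
    proof (rule inj_onI)
      fix i j assume ij: "i \<in> {1..n}" "j \<in> {1..n}" "l i = l j"
      have "(k + int i * h) mod int n = (k + int j * h) mod int n"
        using ij(3) l_int by metis
      then have "int n dvd (k + int i * h) - (k + int j * h)"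
        by (rule mod_eq_dvd_iff[THEN iffD1])
      then have "int n dvd (int i - int j) * h"
        by (simp add: algebra_simps)
      then have "int n dvd int i - int j"
        using cop by (simp add: coprime_commute coprime_dvd_mult_left_iff)
      moreover have "\<bar>int i - int j\<bar> < int n"
        using ij(1,2) by auto
      ultimately show "i = j"
        using dvd_imp_le_int[of "int i - int j" "int n"] by (cases "i = j") auto
    qed
    moreover have "l ` {1..n} \<subseteq> {..<n}"
      using n by (auto simp: l_def nat_less_iff)
    ultimately show ?thesis
      by (simp add: bij_betw_def card_image card_subset_eq)
  qed
  have near_grid: "norm (E (frac (\<theta> + of_nat m * \<alpha>)) - E (of_nat (l m) / of_nat n)) \<le> bd (l m)"
    if m: "m \<in> {1..n}" for m
  proof -
    \<comment> \<open>The drift caused by replacing \<alpha> by \<open>h / n\<close> over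
      \<open>m\<close> steps, in units of \<open>1 / n\<close>; since \<open>m \<le> n\<close>, its
      size stays below 1.\<close>
    define t where "t = of_nat m * (of_nat n * \<alpha> - of_int h)"
    have "of_nat n * \<alpha> - of_int h = of_nat n * (\<alpha> - of_int h / of_nat n)"
      using n by (simp add: right_diff_distrib)
    then have "\<bar>of_nat n * \<alpha> - of_int h\<bar> = of_nat n * \<bar>\<alpha> - of_int h / of_nat n\<bar>"
      by (simp add: abs_mult)
    also have "\<dots> < of_nat n * (1 / (of_nat n)\<^sup>2)"
      using appr n by (intro mult_strict_left_mono) auto
    also have "\<dots> = 1 / of_nat n"
      by (simp add: power2_eq_square)
    finally have "\<bar>of_nat n * \<alpha> - of_int h\<bar> < 1 / of_nat n" .
    then have "real m * \<bar>of_nat n * \<alpha> - of_int h\<bar> < real m * (1 / of_nat n)"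
      using m by (intro mult_strict_left_mono) auto
    also have "\<dots> \<le> 1"
      using m n by simp
    finally have t: "\<bar>t\<bar> < 1"
      by (simp add: t_def abs_mult)
    have s: "0 \<le> s" "s < 1"
      by (auto simp: s_def frac_lt_1)
    define j where "j = (k + int m * h) div int n"
    have ln: "l m < n"
      using bij m by (auto simp: bij_betw_def)
    have "k + int m * h = j * int n + int (l m)"
      by (simp add: l_int j_def)
    then have kj: "real_of_int k + real m * real_of_int h = of_int j * real n + real (l m)"
      by (metis of_int_add of_int_mult of_int_of_nat_eq)
    have "real n * \<theta> = of_int k + s"
      by (simp add: k_def s_def frac_def)
    then have "real n * (\<theta> + of_nat m * \<alpha>) = of_int j * real n + (of_nat (l m) + s + t)"
      using kj by (simp add: t_def algebra_simps)
    also have "\<dots> = real n * (of_int j + (of_nat (l m) + s + t) / of_nat n)"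
      using n by (simp add: field_simps)
    finally have "real n * (\<theta> + of_nat m * \<alpha>) = real n * (of_int j + (of_nat (l m) + s + t) / of_nat n)" .
    then have x: "\<theta> + of_nat m * \<alpha> = of_int j + (of_nat (l m) + s + t) / of_nat n"
      using n by simp
    have grid: "real (l m) / of_nat n \<in> {0..1}"
      using ln by simp
    have fr: "frac (\<theta> + of_nat m * \<alpha>) \<in> {0..1}"
      by (simp add: frac_lt_1 less_imp_le)
    show ?thesis
    proof (cases "l m \<in> {0, n - 1}")
      case True
      have "\<bar>frac (\<theta> + of_nat m * \<alpha>) - of_nat (l m) / of_nat n\<bar> \<le> 1"
        using grid fr unfolding atLeastAtMost_iff by linarith
      then have "C * \<bar>frac (\<theta> + of_nat m * \<alpha>) - of_nat (l m) / of_nat n\<bar> \<le> C"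
        using C by (simp add: mult_left_le)
      moreover have "C \<le> bd (l m)"
        using True C by (simp add: bd_def)
      ultimately show ?thesis
        using lip[OF fr grid] by linarith
    next
      case False
      \<comment> \<open>The offset \<open>s + t\<close> lies in (-1, 2), so for these residues
        \<open>l m + s + t\<close> stays between 0 and \<open>n\<close>, and \<open>frac\<close>
        removes exactly \<open>j\<close>.\<close>
      then have "1 \<le> l m" "l m + 2 \<le> n"
        using ln by auto
      then have "real (l m) \<ge> 1" "real (l m) + 2 \<le> real n"
        by linarith+
      then have "0 \<le> (real (l m) + s + t) / real n" "(real (l m) + s + t) / real n < 1"
        using s t n by (auto simp: field_simps)
      then have fx: "frac (\<theta> + of_nat m * \<alpha>) = (real (l m) + s + t) / real n"
        unfolding x by (simp add: frac_eq)
      have "frac (\<theta> + of_nat m * \<alpha>) - of_nat (l m) / of_nat n = (s + t) / of_nat n"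
        unfolding fx by (simp add: add_divide_distrib)
      moreover have "\<bar>s + t\<bar> / of_nat n \<le> 2 / of_nat n"
        using s t by (intro divide_right_mono) auto
      ultimately have "\<bar>frac (\<theta> + of_nat m * \<alpha>) - of_nat (l m) / of_nat n\<bar> \<le> 2 / of_nat n"
        by simp
      then have "C * \<bar>frac (\<theta> + of_nat m * \<alpha>) - of_nat (l m) / of_nat n\<bar> \<le> C * (2 / of_nat n)"
        using C by (rule mult_left_mono)
      also have "\<dots> = bd (l m)"
        using False by (simp add: bd_def)
      finally show ?thesis
        using lip[OF fr grid] by linarith
    qed
  qed
  have "(\<Sum>m=1..n. E (frac (\<theta> + of_nat m * \<alpha>))) - (\<Sum>l<n. E (of_nat l / of_nat n))
      = (\<Sum>m=1..n. E (frac (\<theta> + of_nat m * \<alpha>)) - E (of_nat (l m) / of_nat n))"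
    using sum.reindex_bij_betw[OF bij, of "\<lambda>l. E (of_nat l / of_nat n)"] by (simp add: sum_subtractf)
  also have "norm \<dots> \<le> (\<Sum>m=1..n. bd (l m))"
    using near_grid by (rule sum_norm_le)
  also have "\<dots> = (\<Sum>j<n. bd j)"
    by (rule sum.reindex_bij_betw[OF bij])
  also have "\<dots> = 2 * C + real (card ({..<n} \<inter> {0, n - 1})) * C"
    using n by (simp add: bd_def sum.distrib sum.If_cases del: insert_iff)
  also have "\<dots> \<le> 2 * C + 2 * C"
  proof -
    have "card ({..<n} \<inter> {0, n - 1}) \<le> card {0, n - 1}"
      by (intro card_mono) auto
    also have "\<dots> \<le> 2"
      by (simp add: card_insert_if)
    finally have "real (card ({..<n} \<inter> {0, n - 1})) \<le> 2"
      by simp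
    then show ?thesis
      using C by (intro add_left_mono mult_right_mono)
  qed
  finally show ?thesis
    by simp
qed

text \<open>The range up to \<open>N\<close> is cut into blocks whose length \<open>n\<close> is the
  denominator of a good approximation to \<alpha>. Each block sum is a grid sum up to
  \<open>4 * C\<close>, and the incomplete last block has fewer than \<open>n\<close> terms, which
  is negligible for large \<open>N\<close>. The case \<open>E 0 \<noteq> E 1\<close>, a jump of the
  periodic extension, is allowed.\<close>

theorem rotation_equidistributed:
  fixes E :: "real \<Rightarrow> 'a::real_normed_vector"
  assumes irr: "\<alpha> \<notin> \<rat>"
    and lip: "\<And>x y. x \<in> {0..1} \<Longrightarrow> y \<in> {0..1} \<Longrightarrow> norm (E x - E y) \<le> C * \<bar>x - y\<bar>"
    and riemann: "(\<lambda>n. (\<Sum>l<n. E (of_nat l / of_nat n)) /\<^sub>R of_nat n) \<longlonglongrightarrow> L"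
  shows "(\<lambda>N. (\<Sum>m=1..N. E (frac (\<theta> + of_nat m * \<alpha>))) /\<^sub>R of_nat N) \<longlonglongrightarrow> L"
proof (rule LIMSEQ_I)
  fix \<epsilon> :: real
  assume \<epsilon>: "\<epsilon> > 0"
  define T where "T \<theta> N = (\<Sum>m=1..N. E (frac (\<theta> + of_nat m * \<alpha>)))" for \<theta> and N :: nat
  have C: "C \<ge> 0"
    using order_trans[OF norm_ge_zero lip[of 0 1]] by simp
  obtain n0 where n0: "\<And>n. n \<ge> n0 \<Longrightarrow> norm ((\<Sum>l<n. E (of_nat l / of_nat n)) /\<^sub>R of_nat n - L) < \<epsilon> / 4"
    using LIMSEQ_D[OF riemann, of "\<epsilon> / 4"] \<epsilon> by auto
  \<comment> \<open>Irrationality gives infinitely many approximations, hence arbitrarily large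
    \<open>k\<close>. Beyond \<open>n0\<close> the grid mean is within \<open>\<epsilon> / 4\<close>
    of \<open>L\<close>; beyond \<open>16 * C / \<epsilon>\<close> the block error
    \<open>4 * C\<close> is at most \<open>n * (\<epsilon> / 4)\<close>.\<close>
  obtain h k where hk: "(h, k) \<in> approx_set \<alpha>" and k: "k > max (int n0) \<lceil>16 * C / \<epsilon>\<rceil>"
    using infinite_approx_set rational_iff_finite_approx_set irr by metis
  define n where "n = nat k"
  have n_k: "k = int n" "n > 0"
    using k by (auto simp: n_def)
  have "16 * C / \<epsilon> < real n"
    using k n_k by linarith
  then have n_C: "4 * C \<le> real n * (\<epsilon> / 4)"
    using \<epsilon> by (simp add: field_simps)
  \<comment> \<open>Uniformity in \<theta> matters: each later block starts at a shifted
    angle.\<close>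
  have block: "norm (T \<theta> n - of_nat n *\<^sub>R L) \<le> of_nat n * (\<epsilon> / 2)" for \<theta>
  proof -
    let ?G = "\<Sum>l<n. E (of_nat l / of_nat n)"
    have "norm (T \<theta> n - ?G) \<le> 4 * C"
      unfolding T_def
      using hk n_k lip by (intro rotation_block_sum[of n h]) (auto simp: approx_set_def)
    moreover have "?G - of_nat n *\<^sub>R L = of_nat n *\<^sub>R (?G /\<^sub>R of_nat n - L)"
      using n_k by (simp add: scaleR_diff_right)
    then have "norm (?G - of_nat n *\<^sub>R L) = of_nat n * norm (?G /\<^sub>R of_nat n - L)"
      by simp
    moreover have "norm (?G /\<^sub>R of_nat n - L) \<le> \<epsilon> / 4"
      using n0[of n] k n_k by simp
    ultimately have "norm (T \<theta> n - ?G) + norm (?G - of_nat n *\<^sub>R L) \<le> of_nat n * (\<epsilon> / 4) + of_nat n * (\<epsilon> / 4)"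
      using n_C by (smt (verit) mult_left_mono of_nat_0_le_iff)
    then show ?thesis
      using norm_triangle_ineq[of "T \<theta> n - ?G" "?G - of_nat n *\<^sub>R L"]
      by (simp add: mult.commute[of \<epsilon>])
  qed
  have T_add: "T \<theta> (M + N) = T \<theta> M + T (\<theta> + of_nat M * \<alpha>) N" for \<theta> M N
  proof (induction N)
    case (Suc N)
    then show ?case
      by (simp add: T_def algebra_simps)
  qed (simp add: T_def)
  have blocks: "norm (T \<theta> (b * n) - of_nat (b * n) *\<^sub>R L) \<le> of_nat (b * n) * (\<epsilon> / 2)" for b
  proof (induction b)
    case (Suc b)
    have "T \<theta> (Suc b * n) - of_nat (Suc b * n) *\<^sub>R L
        = (T \<theta> (b * n) - of_nat (b * n) *\<^sub>R L) + (T (\<theta> + of_nat (b * n) * \<alpha>) n - of_nat n *\<^sub>R L)"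
      using T_add[of \<theta> "b * n" n] by (simp add: algebra_simps)
    also have "norm \<dots> \<le> of_nat (b * n) * (\<epsilon> / 2) + of_nat n * (\<epsilon> / 2)"
      by (rule norm_triangle_mono[OF Suc.IH block])
    finally show ?case
      by (simp add: algebra_simps)
  qed (simp add: T_def)
  \<comment> \<open>A bound for the norm of \<open>E x - L\<close> on the unit interval, where
    \<open>E x\<close> differs from \<open>E 0\<close> by at most \<open>C\<close>.\<close>
  define M where "M = norm (E 0) + C + norm L"
  have "M \<ge> 0"
    using C by (simp add: M_def)
  have rest: "norm (T \<theta> r - of_nat r *\<^sub>R L) \<le> of_nat r * M" for \<theta> r
  proof -
    have E: "norm (E x - L) \<le> M" if "x \<in> {0..1}" for x
    proof -
      have "norm (E x - E 0) \<le> C * \<bar>x - 0\<bar>"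
        using that by (intro lip) auto
      also have "\<dots> \<le> C"
        using that C by (simp add: mult_left_le)
      finally show ?thesis
        using norm_triangle_ineq[of "E x - E 0" "E 0"] norm_triangle_ineq4[of "E x" L]
        by (simp add: M_def)
    qed
    have "T \<theta> r - of_nat r *\<^sub>R L = (\<Sum>m=1..r. E (frac (\<theta> + of_nat m * \<alpha>)) - L)"
      by (simp add: T_def sum_subtractf sum_constant_scaleR)
    also have "norm \<dots> \<le> of_nat (card {1..r}) * M"
      by (intro sum_norm_bound E) (simp add: frac_lt_1 less_imp_le)
    finally show ?thesis
      by simp
  qed
  have bound: "norm (T \<theta> N - of_nat N *\<^sub>R L) \<le> of_nat N * (\<epsilon> / 2) + of_nat n * M" for N
  proof -
    define b r where "b = N div n" and "r = N mod n"
    have N: "N = b * n + r"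
      by (simp add: b_def r_def)
    have "T \<theta> N - of_nat N *\<^sub>R L
        = (T \<theta> (b * n) - of_nat (b * n) *\<^sub>R L) + (T (\<theta> + of_nat (b * n) * \<alpha>) r - of_nat r *\<^sub>R L)"
      unfolding N using T_add[of \<theta> "b * n" r] by (simp add: algebra_simps)
    also have "norm \<dots> \<le> of_nat (b * n) * (\<epsilon> / 2) + of_nat r * M"
      by (rule norm_triangle_mono[OF blocks rest])
    also have "\<dots> \<le> of_nat N * (\<epsilon> / 2) + of_nat n * M"
    proof (intro add_mono mult_right_mono)
      show "real (b * n) \<le> real N"
        by (simp add: N)
      show "real r \<le> real n"
        using n_k by (simp add: r_def less_imp_le)
    qed (use \<epsilon> \<open>M \<ge> 0\<close> in auto)
    finally show ?thesis .
  qed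
  obtain N0 :: nat where N0: "real N0 > of_nat n * M / (\<epsilon> / 2)"
    using reals_Archimedean2 by blast
  show "\<exists>N0. \<forall>N\<ge>N0. norm ((\<Sum>m=1..N. E (frac (\<theta> + of_nat m * \<alpha>))) /\<^sub>R of_nat N - L) < \<epsilon>"
  proof (intro exI allI impI)
    fix N assume N: "N \<ge> Suc N0"
    then have "real N > of_nat n * M / (\<epsilon> / 2)"
      using N0 by linarith
    then have "of_nat n * M < of_nat N * (\<epsilon> / 2)"
      using \<epsilon> by (simp add: field_simps)
    then have *: "norm (T \<theta> N - of_nat N *\<^sub>R L) < of_nat N * \<epsilon>"
      using bound[of N] by (simp add: field_simps)
    have "T \<theta> N /\<^sub>R of_nat N - L = (T \<theta> N - of_nat N *\<^sub>R L) /\<^sub>R of_nat N"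
      using N by (simp add: scaleR_diff_right)
    then have "norm (T \<theta> N /\<^sub>R of_nat N - L) = norm (T \<theta> N - of_nat N *\<^sub>R L) / of_nat N"
      by (simp add: divide_inverse mult.commute)
    also have "\<dots> < \<epsilon>"
      using * N by (simp add: field_simps)
    finally show "norm ((\<Sum>m=1..N. E (frac (\<theta> + of_nat m * \<alpha>))) /\<^sub>R of_nat N - L) < \<epsilon>"
      by (simp add: T_def)
  qed
qed

section \<open>Riemann sums of exponentials and the function \<open>sinc\<close>\<close>

text \<open>The sum is geometric with ratio \<open>w n\<close>, and \<open>n * (w n - 1)\<close>
  tends to \<open>z\<close> because \<open>exp\<close> has derivative 1 at 0.\<close>

lemma Riemann_sum_exp:
  assumes z: "z \<noteq> (0::complex)"
  shows "(\<lambda>n. (\<Sum>l<n. exp (z * of_real (of_nat l / of_nat n))) /\<^sub>R of_nat n) \<longlonglongrightarrow> (exp z - 1) / z"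
proof -
  define w where "w n = exp (z / of_nat n)" for n :: nat
  have "(\<lambda>n. z / of_nat n) \<longlonglongrightarrow> 0"
    by (rule lim_const_over_n)
  then have "filterlim (\<lambda>n. z / of_nat n) (at 0) sequentially"
    using z by (auto simp: filterlim_at eventually_sequentially intro!: exI[of _ 1])
  moreover have "((\<lambda>h. (exp h - 1) / h) \<longlongrightarrow> (1::complex)) (at 0)"
    using DERIV_exp[of "0::complex"] by (simp add: DERIV_def)
  ultimately have "(\<lambda>n. (w n - 1) / (z / of_nat n)) \<longlonglongrightarrow> 1"
    unfolding w_def by (rule filterlim_compose[rotated])
  then have "(\<lambda>n. z * ((w n - 1) / (z / of_nat n))) \<longlonglongrightarrow> z * 1"
    by (rule tendsto_mult_left)
  then have lim: "(\<lambda>n. of_nat n * (w n - 1)) \<longlonglongrightarrow> z"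
    using z by (simp add: mult.commute)
  \<comment> \<open>The nonzero limit excludes, for large \<open>n\<close>, both
    \<open>n = 0\<close> and the degenerate ratio \<open>w n = 1\<close>.\<close>
  then have "eventually (\<lambda>n. of_nat n * (w n - 1) \<noteq> 0) sequentially"
    by (rule tendsto_imp_eventually_ne) (rule z)
  then have "eventually (\<lambda>n. (exp z - 1) / (of_nat n * (w n - 1))
      = (\<Sum>l<n. exp (z * of_real (of_nat l / of_nat n))) /\<^sub>R of_nat n) sequentially"
  proof eventually_elim
    case (elim n)
    then have n: "n > 0" and w: "w n \<noteq> 1"
      by auto
    have "exp (z * of_real (of_nat l / of_nat n)) = w n ^ l" for l
      unfolding w_def by (simp add: exp_of_nat_mult[symmetric] mult.commute)
    then have "(\<Sum>l<n. exp (z * of_real (of_nat l / of_nat n))) = (w n ^ n - 1) / (w n - 1)"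
      using w by (simp add: geometric_sum)
    moreover have "w n ^ n = exp z"
      using n by (simp add: w_def exp_of_nat_mult[symmetric])
    ultimately show ?case
      using n by (simp add: scaleR_conv_of_real field_simps)
  qed
  moreover have "(\<lambda>n. (exp z - 1) / (of_nat n * (w n - 1))) \<longlonglongrightarrow> (exp z - 1) / z"
    by (intro tendsto_divide tendsto_const lim z)
  ultimately show ?thesis
    by (rule Lim_transform_eventually[rotated])
qed

text \<open>The mean of \<open>exp (2 * \<i> * y * (u - 1/2))\<close> over \<open>u\<close> in
  [0, 1]; the value 1 at 0 is the continuous extension.\<close>

definition sinc :: "real \<Rightarrow> real" where
  "sinc y = (if y = 0 then 1 else sin y / y)"

text \<open>For nonzero \<open>y\<close>, doubling the angle and bounding \<open>sin (y / 2)\<close>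
  turn |sin y| = |y| into |y| \<le> |y| |cos (y / 2)|. Hence |cos (y / 2)| = 1, so
  \<open>sin (y / 2)\<close> and with it \<open>sin y\<close> vanish, a contradiction.\<close>

lemma abs_sinc_eq_1D:
  assumes "\<bar>sinc y\<bar> = 1"
  shows "y = 0"
proof (rule ccontr)
  assume y: "y \<noteq> 0"
  then have "\<bar>sin y\<bar> = \<bar>y\<bar>"
    using assms by (simp add: sinc_def abs_divide)
  also have "sin y = 2 * sin (y / 2) * cos (y / 2)"
    using sin_double[of "y / 2"] by simp
  finally have "\<bar>y\<bar> = 2 * \<bar>sin (y / 2)\<bar> * \<bar>cos (y / 2)\<bar>"
    by (simp add: abs_mult)
  also have "\<dots> \<le> \<bar>y\<bar> * \<bar>cos (y / 2)\<bar>"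
    using abs_sin_x_le_abs_x[of "y / 2"] by (intro mult_right_mono) auto
  finally have "\<bar>cos (y / 2)\<bar> = 1"
    using y abs_cos_le_one[of "y / 2"] by (simp add: mult_le_cancel_left1)
  then have "sin (y / 2) = 0"
    using sin_cos_squared_add[of "y / 2"] by (metis abs_1 add_cancel_left_left power2_eq_iff abs_if power_one zero_eq_power2)
  then have "sin y = 0"
    using \<open>sin y = 2 * sin (y / 2) * cos (y / 2)\<close> by simp
  with \<open>\<bar>sin y\<bar> = \<bar>y\<bar>\<close> y show False
    by simp
qed

text \<open>Equidistribution turns the orbit mean into an integral over [0, 1]; centring at 1/2
  makes that integral real.\<close>

lemma rotation_mean_exp:
  assumes "\<alpha> \<notin> \<rat>"
  shows "(\<lambda>N. (\<Sum>m=1..N. exp (\<i> * of_real (2 * y * (frac (\<theta> + of_nat m * \<alpha>) - 1/2)))) /\<^sub>R of_nat N)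
    \<longlonglongrightarrow> of_real (sinc y)"
proof (rule rotation_equidistributed[OF assms])
  define E where "E x = exp (\<i> * of_real (2 * y * (x - 1/2)))" for x
  have "norm (E u - E v) \<le> 2 * \<bar>y\<bar> * \<bar>u - v\<bar>" for u v
  proof -
    \<comment> \<open>The factor \<open>E v\<close> has modulus 1, so the chord length of the unit
      circle gives the Lipschitz constant.\<close>
    have "E u - E v = E v * (exp (\<i> * of_real (2 * y * (u - v))) - 1)"
      by (simp add: E_def algebra_simps flip: exp_add)
    then have "norm (E u - E v) = 2 * \<bar>sin (y * (u - v))\<bar>"
      using dist_exp_i_1[of "2 * y * (u - v)"] by (simp add: norm_mult E_def)
    then show ?thesis
      using abs_sin_x_le_abs_x[of "y * (u - v)"] by (simp add: abs_mult)
  qed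
  then show "norm (exp (\<i> * of_real (2 * y * (u - 1/2))) - exp (\<i> * of_real (2 * y * (v - 1/2))))
      \<le> 2 * \<bar>y\<bar> * \<bar>u - v\<bar>" for u v
    by (simp add: E_def)
  have "(\<lambda>n. (\<Sum>l<n. E (of_nat l / of_nat n)) /\<^sub>R of_nat n) \<longlonglongrightarrow> of_real (sinc y)"
  proof (cases "y = 0")
    case True
    have "eventually (\<lambda>n. (\<Sum>l<n. E (of_nat l / of_nat n)) /\<^sub>R of_nat n = 1) sequentially"
      using eventually_gt_at_top[of 0]
      by eventually_elim (simp add: E_def True scaleR_conv_of_real)
    then show ?thesis
      using tendsto_eventually by (simp add: True sinc_def)
  next
    case False
    define z where "z = \<i> * of_real (2 * y)"
    have z: "z \<noteq> 0"
      using False by (simp add: z_def)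
    have "E x = exp (- z / 2) * exp (z * of_real x)" for x
      by (simp add: E_def z_def algebra_simps flip: exp_add)
    then have "(\<lambda>n. (\<Sum>l<n. E (of_nat l / of_nat n)) /\<^sub>R of_nat n)
        = (\<lambda>n. exp (- z / 2) * ((\<Sum>l<n. exp (z * of_real (of_nat l / of_nat n))) /\<^sub>R of_nat n))"
      by (simp add: sum_distrib_left)
    moreover have "\<dots> \<longlonglongrightarrow> exp (- z / 2) * ((exp z - 1) / z)"
      by (intro tendsto_mult_left Riemann_sum_exp z)
    moreover have "exp (- z / 2) * ((exp z - 1) / z) = of_real (sinc y)"
    proof -
      have "exp (- z / 2) * (exp z - 1) = exp (\<i> * of_real y) - exp (- (\<i> * of_real y))"
        by (simp add: z_def algebra_simps flip: exp_add)
      also have "\<dots> = 2 * \<i> * of_real (sin y)"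
        by (simp add: sin_of_real[symmetric] sin_exp_eq field_simps)
      finally show ?thesis
        using False by (simp add: z_def sinc_def)
    qed
    ultimately show ?thesis
      by simp
  qed
  then show "(\<lambda>n. (\<Sum>l<n. exp (\<i> * of_real (2 * y * (of_nat l / of_nat n - 1/2)))) /\<^sub>R of_nat n)
      \<longlonglongrightarrow> of_real (sinc y)"
    by (simp add: E_def)
qed

section \<open>Constants of the chain, peak phases and structure factors\<close>

lemma golden_squared: "golden\<^sup>2 = golden + 1"
  by (simp add: golden_def power2_eq_square field_simps)

lemma golden_pos: "golden > 0"
  by (simp add: golden_def add_pos_nonneg)

lemma mean_spacing_pos: "mean_spacing > 0"
  using golden_pos by (simp add: mean_spacing_def)

text \<open>The argument of \<open>sinc\<close> at a peak. It takes the integer coordinates, in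
  which it is linear, so that translation by a peak of phase 0 preserves every intensity.\<close>

definition peak_phase :: "real \<Rightarrow> real \<Rightarrow> int \<Rightarrow> int \<Rightarrow> real" where
  "peak_phase A B n\<^sub>1 n\<^sub>2 = pi * (of_int (n\<^sub>1 + n\<^sub>2) * B - of_int n\<^sub>1 * A) / mean_spacing"

lemma peak_phase_add:
  "peak_phase A B (n\<^sub>1 + m\<^sub>1) (n\<^sub>2 + m\<^sub>2) = peak_phase A B n\<^sub>1 n\<^sub>2 + peak_phase A B m\<^sub>1 m\<^sub>2"
  by (simp add: peak_phase_def add_divide_distrib[symmetric] algebra_simps)

lemma peak_phase_eq_0_iff:
  "peak_phase A B n\<^sub>1 n\<^sub>2 = 0 \<longleftrightarrow> of_int (n\<^sub>1 + n\<^sub>2) * B = of_int n\<^sub>1 * A"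
  using mean_spacing_pos by (simp add: peak_phase_def)

text \<open>With \<open>r\<close> the rounding of \<open>m / \<tau>\<close>, the phase of the \<open>m\<close>-th term is
  \<open>2 y (m / \<tau> - r)\<close> plus \<open>2 \<pi>\<close> times the integer \<open>n\<^sub>1 m + n\<^sub>2 r\<close>, where \<open>y\<close> is the peak phase.\<close>

lemma structure_factor_fibonacci_chain:
  assumes mean: "A / golden + B * (1 - 1 / golden) = mean_spacing"
  shows "structure_factor (fibonacci_chain A B) (of_int n\<^sub>1 * k\<^sub>0 + of_int n\<^sub>2 * q\<^sub>0)
    = of_real (sinc (peak_phase A B n\<^sub>1 n\<^sub>2))"
proof -
  define K where "K = of_int n\<^sub>1 * k\<^sub>0 + of_int n\<^sub>2 * q\<^sub>0"
  define y where "y = peak_phase A B n\<^sub>1 n\<^sub>2"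
  define g where "g = 1 / golden"
  have a: "mean_spacing = A * g + B * (1 - g)"
    using mean by (simp add: g_def)
  have summand: "exp (\<i> * of_real (K * fibonacci_chain A B (int m)))
      = exp (\<i> * of_real (2 * y * (frac (1/2 + of_nat m * (1 / golden)) - 1/2)))" for m
  proof -
    define r where "r = round (of_nat m * g)"
    \<comment> \<open>The shift by 1/2 turns the floor inside \<open>frac\<close> into
      \<open>round\<close>.\<close>
    have fr: "frac (1/2 + of_nat m * (1 / golden)) - 1/2 = of_nat m * g - of_int r"
      by (simp add: frac_def r_def round_def g_def add.commute)
    have x: "fibonacci_chain A B (int m) = of_int r * A + (of_nat m - of_int r) * B"
      by (simp add: fibonacci_chain_def r_def g_def)
    \<comment> \<open>Multiplying by \<open>mean_spacing\<close> clears the denominator of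
      \<open>k\<^sub>0\<close> and \<open>q\<^sub>0\<close>; expanding it again by \<open>a\<close>
      splits off an integer multiple of 2 pi.\<close>
    have "mean_spacing * (K * fibonacci_chain A B (int m))
        = 2 * pi * ((of_int n\<^sub>1 + of_int n\<^sub>2 * g) * (of_int r * A + (of_nat m - of_int r) * B))"
      using mean_spacing_pos
      by (simp add: K_def k\<^sub>0_def q\<^sub>0_def x g_def divide_simps) (simp add: algebra_simps)
    also have "\<dots> = 2 * pi * (of_int (n\<^sub>1 + n\<^sub>2) * B - of_int n\<^sub>1 * A) * (of_nat m * g - of_int r)
        + mean_spacing * (2 * pi * of_int (n\<^sub>1 * int m + n\<^sub>2 * r))"
      unfolding a by (simp add: algebra_simps)
    also have "2 * pi * (of_int (n\<^sub>1 + n\<^sub>2) * B - of_int n\<^sub>1 * A) = mean_spacing * (2 * y)"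
      using mean_spacing_pos by (simp add: y_def peak_phase_def)
    finally have "mean_spacing * (K * fibonacci_chain A B (int m))
        = mean_spacing * (2 * y * (of_nat m * g - of_int r) + 2 * pi * of_int (n\<^sub>1 * int m + n\<^sub>2 * r))"
      by (simp only: distrib_left mult.assoc)
    then have "K * fibonacci_chain A B (int m)
        = 2 * y * (of_nat m * g - of_int r) + 2 * pi * of_int (n\<^sub>1 * int m + n\<^sub>2 * r)"
      using mean_spacing_pos by (metis mult_left_cancel less_irrefl)
    then have "cis (K * fibonacci_chain A B (int m)) = cis (2 * y * (of_nat m * g - of_int r))"
      by (simp only: cis_mult[symmetric] cis_multiple_2pi Ints_of_int mult_1_right)
    then show ?thesis
      by (simp only: fr cis_conv_exp)
  qed
  have "1 / golden \<notin> \<rat>"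
    using golden_irrational by (metis Rats_divide Rats_1 div_by_1 divide_divide_eq_right mult_1)
  then have "(\<lambda>N. (\<Sum>m=1..N. exp (\<i> * of_real (K * fibonacci_chain A B (int m)))) /\<^sub>R of_nat N)
      \<longlonglongrightarrow> of_real (sinc y)"
    unfolding summand by (rule rotation_mean_exp)
  then show ?thesis
    unfolding structure_factor_def K_def[symmetric] y_def[symmetric]
    by (intro limI) (simp add: scaleR_conv_of_real divide_inverse)
qed

section \<open>Periods of the diffraction pattern\<close>

theorem mainTheorem2:
  fixes \<epsilon> A B \<kappa> :: real
  assumes A: "A = golden - \<epsilon> / golden" "A > 0"
    and B: "B = 1 + \<epsilon>" "B > 0"
    and \<kappa>: "\<kappa> = A / B"
  shows "(commensurate (fibonacci_chain A B) \<longleftrightarrow> \<kappa> \<in> \<rat>) \<and>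
    (\<forall>p q :: int. p > 0 \<and> q > 0 \<and> \<kappa> = of_int p / of_int q \<longrightarrow>
       diffraction_periodic (fibonacci_chain A B) (2 * pi * of_int p / A))"
proof -
  let ?x = "fibonacci_chain A B"
  define g where "g = 1 / golden"
  have golden_g: "golden = 1 + g"
    using golden_squared golden_pos by (simp add: g_def field_simps power2_eq_square)
  have gg: "g * g = 1 - g"
    using golden_g golden_pos by (simp add: g_def field_simps)
  have "mean_spacing * (golden + 1) = golden + 2"
    using golden_pos by (simp add: mean_spacing_def)
  \<comment> \<open>Here \<open>golden + 2 = 3 + g\<close>, which factors as shown because
    \<open>g * g = 1 - g\<close>.\<close>
  then have "mean_spacing * (2 + g) = (2 - g) * (2 + g)"
    using gg by (simp add: golden_g algebra_simps)
  then have a: "mean_spacing = 2 - g"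
    using golden_pos by (simp add: g_def add_pos_pos less_imp_neq[symmetric])
  \<comment> \<open>The average spacing does not depend on \<epsilon>: its coefficient
    \<open>g * g - 1 + g\<close> is zero, thanks to the way \<epsilon> enters both \<open>A\<close>
    and \<open>B\<close>.\<close>
  have mean: "A / golden + B * (1 - 1 / golden) = mean_spacing"
  proof -
    have "A = 1 + g - \<epsilon> * g"
      using A(1) golden_g by (simp add: g_def)
    then have "A * g + B * (1 - g) = (1 + g - \<epsilon> * g) * g + (1 + \<epsilon>) * (1 - g)"
      using B(1) by simp
    also have "\<dots> = 1 + g * g - \<epsilon> * (g * g - 1 + g)"
      by (simp add: algebra_simps)
    finally have "A * g + B * (1 - g) = 1 + g * g - \<epsilon> * (g * g - 1 + g)" .
    then show ?thesis
      using a gg by (simp add: g_def)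
  qed
  have intensity: "intensity ?x (of_int n\<^sub>1 * k\<^sub>0 + of_int n\<^sub>2 * q\<^sub>0) = (sinc (peak_phase A B n\<^sub>1 n\<^sub>2))\<^sup>2"
    for n\<^sub>1 n\<^sub>2
    by (simp add: intensity_def structure_factor_fibonacci_chain[OF mean])

  have periodic: "diffraction_periodic ?x (2 * pi * of_int p / A)"
    if pq: "p > 0" "q > 0" "\<kappa> = of_int p / of_int q" for p q :: int
  proof -
    define P where "P = 2 * pi * of_int p / A"
    have AqBp: "A * of_int q = of_int p * B"
      using pq B(2) \<kappa> by (simp add: field_simps)
    \<comment> \<open>The coordinates solve
      \<open>(n\<^sub>1 + n\<^sub>2) * B = n\<^sub>1 * A\<close> with \<open>n\<^sub>1 = q\<close>
      and \<open>n\<^sub>1 + n\<^sub>2 = p\<close>, so the phase of \<open>P\<close>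
      vanishes.\<close>
    have P: "P = of_int q * k\<^sub>0 + of_int (p - q) * q\<^sub>0"
    proof -
      have "A * (of_int q * k\<^sub>0 + of_int (p - q) * q\<^sub>0)
          = 2 * pi * (A * of_int q * (1 - g) + A * of_int p * g) / mean_spacing"
        by (simp add: k\<^sub>0_def q\<^sub>0_def g_def add_divide_distrib diff_divide_distrib algebra_simps)
      also have "\<dots> = 2 * pi * of_int p * (A / golden + B * (1 - 1 / golden)) / mean_spacing"
        unfolding AqBp by (simp add: g_def algebra_simps)
      also have "\<dots> = A * P"
        using mean mean_spacing_pos A(2) by (simp add: P_def)
      finally show ?thesis
        using A(2) by simp
    qed
    have shift: "of_int n\<^sub>1 * k\<^sub>0 + of_int n\<^sub>2 * q\<^sub>0 + P
        = of_int (n\<^sub>1 + q) * k\<^sub>0 + of_int (n\<^sub>2 + (p - q)) * q\<^sub>0" for n\<^sub>1 n\<^sub>2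
      by (simp add: P algebra_simps)
    have "peak_phase A B q (p - q) = 0"
      using AqBp by (simp add: peak_phase_eq_0_iff mult.commute)
    then have "intensity ?x (K + P) = intensity ?x K" if "K \<in> peak_positions" for K
      using that by (auto simp: peak_positions_def shift intensity peak_phase_add simp del: of_int_add of_int_diff)
    moreover have "(\<lambda>K. K + P) ` peak_positions = peak_positions"
    proof
      show "(\<lambda>K. K + P) ` peak_positions \<subseteq> peak_positions"
        unfolding peak_positions_def using shift by blast
      show "peak_positions \<subseteq> (\<lambda>K. K + P) ` peak_positions"
      proof
        fix K assume "K \<in> peak_positions"
        then obtain n\<^sub>1 n\<^sub>2 where "K = of_int n\<^sub>1 * k\<^sub>0 + of_int n\<^sub>2 * q\<^sub>0"
          by (auto simp: peak_positions_def)
        then have "K = of_int (n\<^sub>1 - q) * k\<^sub>0 + of_int (n\<^sub>2 - (p - q)) * q\<^sub>0 + P"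
          using shift[of "n\<^sub>1 - q" "n\<^sub>2 - (p - q)"] by simp
        then show "K \<in> (\<lambda>K. K + P) ` peak_positions"
          unfolding peak_positions_def by blast
      qed
    qed
    moreover have "P \<noteq> 0"
      using pq A(2) by (simp add: P_def)
    ultimately show ?thesis
      by (simp add: diffraction_periodic_def P_def)
  qed

  have "\<kappa> \<in> \<rat>" if per: "diffraction_periodic ?x P" for P
  proof -
    have zero: "0 \<in> peak_positions"
      unfolding peak_positions_def by (rule CollectI) (intro exI[of _ 0], simp)
    then have "0 + P \<in> peak_positions"
      using per unfolding diffraction_periodic_def by blast
    then obtain n\<^sub>1 n\<^sub>2 where P: "P = of_int n\<^sub>1 * k\<^sub>0 + of_int n\<^sub>2 * q\<^sub>0"
      by (auto simp: peak_positions_def)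
    have "intensity ?x P = intensity ?x 0"
      using per zero by (auto simp: diffraction_periodic_def)
    then have "(sinc (peak_phase A B n\<^sub>1 n\<^sub>2))\<^sup>2 = 1"
      using intensity[of 0 0] by (simp add: P intensity peak_phase_def[of _ _ 0 0] sinc_def[of 0])
    then have "\<bar>sinc (peak_phase A B n\<^sub>1 n\<^sub>2)\<bar> = 1"
      by (auto simp: power2_eq_1_iff)
    then have eq: "of_int (n\<^sub>1 + n\<^sub>2) * B = of_int n\<^sub>1 * A"
      using abs_sinc_eq_1D peak_phase_eq_0_iff by blast
    \<comment> \<open>This coordinate becomes the denominator of \<kappa>; were it 0, positivity of
      \<open>B\<close> would force \<open>P = 0\<close>.\<close>
    have "n\<^sub>1 \<noteq> 0"
    proof
      assume "n\<^sub>1 = 0"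
      with eq B(2) have "n\<^sub>2 = 0"
        by simp
      with \<open>n\<^sub>1 = 0\<close> P per show False
        by (simp add: diffraction_periodic_def)
    qed
    then have "\<kappa> = of_int (n\<^sub>1 + n\<^sub>2) / of_int n\<^sub>1"
      using eq B(2) by (simp add: \<kappa> field_simps)
    then show ?thesis
      by simp
  qed
  moreover have "commensurate ?x" if "\<kappa> \<in> \<rat>"
  proof -
    obtain p q :: int where q: "q > 0" "\<kappa> = of_int p / of_int q"
      using \<open>\<kappa> \<in> \<rat>\<close> by (meson Rats_cases')
    moreover have "\<kappa> > 0"
      using A(2) B(2) by (simp add: \<kappa>)
    ultimately have "p > 0"
      by (simp add: zero_less_divide_iff)
    with q show ?thesis
      using periodic commensurate_def by blast
  qed
  ultimately show ?thesis
    using periodic commensurate_def by blast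
qed

end
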